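(* Let $n\ge 1$ be an integer, let $f\in\mathcal{A}_n$, $0\leq\alpha<1$ and $\lambda>0$. Suppose that $$\left|zf''(z)-\alpha\left(f'(z)-\frac{f(z)}{z}\right)\right|<\delta\qquad(z\in\mathbb{D}),$$ where $\delta$ is the smallest positive root of $$\phi(r):=(1+n)\bigl(2\alpha n-\lambda(n+1)-n\bigr)r^2+n(1-\alpha+n)\bigl(2\lambda(n+1)+n+\alpha n^2\bigr)r-\lambda n^2(n+1-\alpha)^2.$$ Then $f\in G_{\lambda,\alpha}$.
   Context: $\mathbb{D}=\{z\in\mathbb{C}:|z|<1\}$. For an integer $n\ge1$, $\mathcal{A}_n$ is the class of analytic functions on $\mathbb{D}$ of the form $f(z)=z+a_{n+1}z^{n+1}+a_{n+2}z^{n+2}+\cdots$, and $\mathcal{A}=\mathcal{A}_1$. For $0\le\alpha\le1$ and $\lambda>0$, $$G_{\lambda,\alpha}=\left\{f\in\mathcal{A}:\left|\frac{1-\alpha+\alpha zf''(z)/f'(z)}{zf'(z)/f(z)}-(1-\alpha)\right|<\lambda,\ z\in\mathbb{D}\right\},$$ where expressions such as $f(z)/z$ and $zf'(z)/f(z)$ are given their limiting values at $z=0$. *)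

theory Defs
  imports "HOL-Complex_Analysis.Complex_Analysis"
begin

abbreviation unit_disc :: "complex set" where
  "unit_disc \<equiv> ball 0 1"

definition class_A :: "nat \<Rightarrow> (complex \<Rightarrow> complex) set" where
  "class_A n = {f. f holomorphic_on unit_disc \<and>
     (\<exists>a :: nat \<Rightarrow> complex. \<forall>z\<in>unit_disc.
        (\<lambda>k. a (n + 1 + k) * z ^ (n + 1 + k)) sums (f z - z))}"

text \<open>Quotients such as \<open>f z / z\<close> take their limiting value at \<open>0\<close>
  (HOL division would give \<open>0 / 0 = 0\<close> there).\<close>

definition lim_at_0 :: "(complex \<Rightarrow> complex) \<Rightarrow> complex \<Rightarrow> complex" where
  "lim_at_0 g z = (if z = 0 then Lim (at 0) g else g z)"

text \<open>Since HOL division is total, the definedness of the quotients is stated explicitly: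
  \<open>deriv f\<close> has no zero in the disc and \<open>f\<close> has none apart from \<open>0\<close>.\<close>

definition class_G :: "real \<Rightarrow> real \<Rightarrow> (complex \<Rightarrow> complex) set" where
  "class_G lam \<alpha> = {f \<in> class_A 1.
     (\<forall>z\<in>unit_disc. deriv f z \<noteq> 0 \<and> (z \<noteq> 0 \<longrightarrow> f z \<noteq> 0)) \<and>
     (\<forall>z\<in>unit_disc.
        cmod ((1 - of_real \<alpha> + of_real \<alpha> * (z * deriv (deriv f) z / deriv f z))
                / lim_at_0 (\<lambda>w. w * deriv f w / f w) z
              - (1 - of_real \<alpha>)) < lam)}"

definition phi :: "nat \<Rightarrow> real \<Rightarrow> real \<Rightarrow> real \<Rightarrow> real" where
  "phi n \<alpha> lam r =
     (1 + real n) * (2 * \<alpha> * real n - lam * (real n + 1) - real n) * r\<^sup>2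
     + real n * (1 - \<alpha> + real n) * (2 * lam * (real n + 1) + real n + \<alpha> * (real n)\<^sup>2) * r
     - lam * (real n)\<^sup>2 * (real n + 1 - \<alpha>)\<^sup>2"

definition smallest_positive_root :: "(real \<Rightarrow> real) \<Rightarrow> real \<Rightarrow> bool" where
  "smallest_positive_root p d \<longleftrightarrow>
     d > 0 \<and> p d = 0 \<and> (\<forall>r. r > 0 \<longrightarrow> p r = 0 \<longrightarrow> d \<le> r)"

end

theory Submission
  imports Defs
begin

text \<open>
  Write \<open>f z = z * (1 + z ^ n * h z)\<close>, \<open>q = n h + z h'\<close> and \<open>D = n + 1 - \<alpha>\<close>. The quantity bounded
  by \<open>\<delta>\<close> is \<open>z ^ n * (D q + z q')\<close>, so Schwarz's lemma gives \<open>\<bar>D q + z q'\<bar> \<le> \<delta>\<close>, and integrating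
  along radii twice gives \<open>\<bar>q\<bar> \<le> \<delta> / D\<close> and \<open>\<bar>h\<bar> \<le> \<delta> / (n D)\<close>. With \<open>s = (\<delta> / D) \<bar>z\<bar> ^ n\<close> this bounds
  \<open>f z / z\<close>, \<open>f' z - f z / z\<close>, \<open>z f'' z\<close> and \<open>1 / f' z\<close>, and the resulting estimate of the
  expression defining the class is below \<open>lam\<close> exactly when \<open>phi (s D) < 0\<close>. The latter holds
  because \<open>phi 0 < 0\<close> and \<open>phi\<close> has no root in \<open>(0, \<delta>)\<close>.
\<close>

section \<open>Schwarz's lemma and integration along radii\<close>

text \<open>The maximum modulus principle on the circle of radius \<open>r\<close> gives the bound
  \<open>M / r ^ n\<close>, and \<open>r\<close> then tends to 1. These circles avoid 0, so the
  bound at 0 need not be assumed, and the limiting value of \<open>f z / z\<close> there need not be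
  computed later.\<close>

lemma Schwarz_power:
  fixes W :: "complex \<Rightarrow> complex"
  assumes W: "W holomorphic_on ball 0 1"
    and bound: "\<And>z. cmod z < 1 \<Longrightarrow> z \<noteq> 0 \<Longrightarrow> cmod (z ^ n * W z) \<le> M"
    and z: "cmod z < 1"
  shows "cmod (W z) \<le> M"
proof -
  have circ: "cmod (W z) \<le> M / r ^ n" if r: "cmod z < r" "r < 1" for r
  proof (rule maximum_modulus_frontier[of W "cball 0 r"])
    have r0: "0 < r" using r(1) norm_ge_zero[of z] by linarith
    have sub: "cball 0 r \<subseteq> ball (0::complex) 1" using r by auto
    show "W holomorphic_on interior (cball 0 r)"
      by (rule holomorphic_on_subset[OF W]) (use sub interior_subset in blast)
    show "continuous_on (closure (cball 0 r)) W"
      using holomorphic_on_imp_continuous_on[OF holomorphic_on_subset[OF W sub]] by simp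
    show "bounded (cball (0::complex) r)" by simp
    show "z \<in> cball 0 r" using r by simp
    fix w :: complex assume "w \<in> frontier (cball 0 r)"
    hence w: "cmod w = r" using r0 by (simp add: frontier_cball)
    hence "r ^ n * cmod (W w) \<le> M"
      using bound[of w] r r0 by (auto simp: norm_mult norm_power)
    thus "cmod (W w) \<le> M / r ^ n" using r0 by (simp add: field_simps)
  qed
  have "((\<lambda>r. M / r ^ n) \<longlongrightarrow> M / 1 ^ n) (at_left (1::real))"
    by (intro tendsto_intros) auto
  moreover have "\<forall>\<^sub>F r in at_left (1::real). cmod (W z) \<le> M / r ^ n"
    using eventually_at_left[OF z] z circ by auto
  ultimately show ?thesis
    by (metis div_by_1 power_one tendsto_lowerbound trivial_limit_at_left_real)
qed

text \<open>The derivative of \<open>t \<mapsto> t powr c * q (t z)\<close> is \<open>t powr (c - 1)\<close> times the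
  expression bounded by \<open>M\<close>.\<close>

lemma Euler_operator_bound:
  fixes q :: "complex \<Rightarrow> complex"
  assumes q: "q holomorphic_on ball 0 1" and c: "c > 0"
    and bound: "\<And>z. cmod z < 1 \<Longrightarrow> cmod (of_real c * q z + z * deriv q z) \<le> M"
    and z: "cmod z < 1"
  shows "cmod (q z) \<le> M / c"
proof -
  have tz: "cmod (of_real t * z) < 1" if "0 \<le> t" "t \<le> 1" for t
  proof -
    have "t * cmod z \<le> 1 * cmod z" by (rule mult_right_mono) (use that in auto)
    thus ?thesis using z that by (simp add: norm_mult)
  qed
  define u where "u = (\<lambda>t::real. of_real (t powr c) * q (of_real t * z))"
  define u' where "u' = (\<lambda>t::real. of_real (t powr (c - 1)) *
      (of_real c * q (of_real t * z) + of_real t * z * deriv q (of_real t * z)))"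
  \<comment> \<open>Mean value inequality with a majorant whose derivative is
    \<open>M * t powr (c - 1)\<close>. As \<open>0 powr c = 0\<close>, both terms at 0
    vanish.\<close>
  have "norm (u 1 - u 0) \<le> M * 1 powr c / c - M * 0 powr c / c"
  proof (rule differentiable_bound_general[where f = u and f' = u'
        and \<phi> = "\<lambda>t. M * t powr c / c" and \<phi>' = "\<lambda>t. M * t powr (c - 1)"])
    show "continuous_on {0..1} (\<lambda>t. M * t powr c / c)"
      using c by (intro continuous_intros continuous_on_powr') auto
    have "continuous_on {0..1} (\<lambda>t::real. q (of_real t * z))"
      by (rule continuous_on_compose2[OF holomorphic_on_imp_continuous_on[OF q]])
         (use tz in \<open>auto intro!: continuous_intros\<close>)
    thus "continuous_on {0..1} u"
      unfolding u_def using c by (intro continuous_intros continuous_on_powr') auto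
    fix t :: real assume t: "0 < t" "t < 1"
    have tp: "t powr c = t powr (c - 1) * t" using t by (simp add: powr_diff)
    show "((\<lambda>t. M * t powr c / c) has_vector_derivative M * t powr (c - 1)) (at t)"
      unfolding has_real_derivative_iff_has_vector_derivative[symmetric]
      using t c by (auto intro!: derivative_eq_intros simp: tp)
    have dq: "(q has_field_derivative deriv q (of_real t * z)) (at (of_real t * z))"
      using q tz[of t] t by (intro holomorphic_derivI[of q "ball 0 1"]) auto
    have "((\<lambda>t::real. of_real t * z) has_vector_derivative z) (at t)"
      by (auto intro!: derivative_eq_intros)
    from field_vector_diff_chain_at[OF this dq]
    have 1: "((\<lambda>t::real. q (of_real t * z)) has_vector_derivative z * deriv q (of_real t * z)) (at t)"
      by (simp add: o_def)
    have "((\<lambda>t. t powr c) has_real_derivative c * t powr (c - 1)) (at t)"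
      using t by (auto intro!: derivative_eq_intros simp: tp)
    from has_vector_derivative_mult[OF has_vector_derivative_of_real[OF this] 1]
    show "(u has_vector_derivative u' t) (at t)"
      unfolding u_def u'_def by (simp add: tp algebra_simps)
    show "norm (u' t) \<le> M * t powr (c - 1)"
      unfolding u'_def norm_mult using bound[OF tz[of t]] t
      by (simp add: mult.commute mult_left_mono)
  qed simp
  thus ?thesis using c by (simp add: u_def)
qed

section \<open>The sign of \<open>phi\<close> below its smallest positive root\<close>

lemma phi_neg:
  assumes "lam > 0" "\<alpha> < 1" "n \<ge> 1" "smallest_positive_root (phi n \<alpha> lam) \<delta>" "0 \<le> r" "r < \<delta>"
  shows "phi n \<alpha> lam r < 0"
proof (rule ccontr)
  assume c: "\<not> ?thesis"
  have 0: "phi n \<alpha> lam 0 < 0" using assms by (simp add: phi_def)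
  have "continuous_on {0..r} (phi n \<alpha> lam)" unfolding phi_def by (intro continuous_intros)
  with IVT'[of "phi n \<alpha> lam" 0 0 r] 0 c assms obtain x where "0 \<le> x" "x \<le> r" "phi n \<alpha> lam x = 0" by auto
  moreover from this 0 have "x > 0" by (cases "x = 0") auto
  ultimately show False using assms unfolding smallest_positive_root_def by force
qed

text \<open>Regrouping around \<open>n * D - (n + 1) * r\<close>, which becomes
  \<open>n * D * L\<close> for \<open>r = s * D\<close>. In this form \<open>phi\<close> is the
  estimate of the class expression with denominators cleared.\<close>

lemma phi_eq:
  fixes n :: nat and \<alpha> D :: real
  defines "D \<equiv> real n + 1 - \<alpha>"
  shows "phi n \<alpha> lam r = (1 - \<alpha>) * r * n * (n * D - (real n + 1) * r)
           + \<alpha> * r * (real n + 1) * n * (n * D + r) - lam * (n * D - (real n + 1) * r)\<^sup>2"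
  unfolding phi_def D_def by (simp add: power2_eq_square algebra_simps)

text \<open>At the zero \<open>r\<close> of \<open>n * D - (n + 1) * r\<close>, only the nonnegative
  middle term of \<open>phi_eq\<close> survives, so \<open>phi_neg\<close> excludes
  \<open>r < \<delta>\<close>. This yields the positivity of \<open>L\<close>, the later lower bound
  for the modulus of \<open>deriv f z\<close>.\<close>

lemma smallest_positive_root_phi_le:
  assumes "n \<ge> 1" "0 \<le> \<alpha>" "\<alpha> < 1" "lam > 0" "smallest_positive_root (phi n \<alpha> lam) \<delta>"
  shows "(real n + 1) * \<delta> \<le> n * (real n + 1 - \<alpha>)"
proof (rule ccontr)
  assume c: "\<not> ?thesis"
  define D where "D = real n + 1 - \<alpha>"
  define r where "r = n * D / (real n + 1)"
  have D: "D > 0" using assms by (simp add: D_def)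
  have r: "(real n + 1) * r = n * D" "0 \<le> r"
    using D by (auto simp: r_def add_eq_0_iff)
  have "r < \<delta>" using c[folded D_def] by (simp add: r_def field_simps)
  have "phi n \<alpha> lam r = \<alpha> * r * (real n + 1) * n * (n * D + r)"
    unfolding phi_eq D_def[symmetric] using r(1) by simp
  also have "\<dots> \<ge> 0" using assms r D by simp
  finally show False using phi_neg[OF assms(4,3,1,5) r(2) \<open>r < \<delta>\<close>] by simp
qed

text \<open>The second claim is \<open>phi n \<alpha> lam (s * D) < 0\<close> divided by
  \<open>(n * D * L)\<^sup>2\<close>.\<close>

lemma phi_estimate:
  fixes n :: nat and \<alpha> s L :: real
  assumes "n \<ge> 1" "0 \<le> \<alpha>" "\<alpha> < 1" "lam > 0" "smallest_positive_root (phi n \<alpha> lam) \<delta>"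
    and s: "0 \<le> s" "s < \<delta> / (real n + 1 - \<alpha>)"
  defines "L \<equiv> 1 - s * (real n + 1) / n"
  shows "L > 0" "(1 - \<alpha>) * s / L + \<alpha> * (s * (real n + 1)) * (1 + s / n) / L\<^sup>2 < lam"
proof -
  define D where "D = real n + 1 - \<alpha>"
  have D: "D > 0" using assms by (simp add: D_def)
  have n: "real n > 0" using assms by simp
  have sD: "s * D < \<delta>" using s D by (simp add: D_def field_simps)
  have L: "n * D - (real n + 1) * (s * D) = n * D * L" using n by (simp add: L_def field_simps)
  have t: "n * D + s * D = n * D * (1 + s / n)" using n by (simp add: field_simps)
  have "(real n + 1) * (s * D) < (real n + 1) * \<delta>" using sD by simp
  also have "\<dots> \<le> n * D" unfolding D_def by (rule smallest_positive_root_phi_le[OF assms(1-5)])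
  finally have "0 < n * D * L" using L by simp
  thus L0: "L > 0" using n D by (metis mult_pos_pos zero_less_mult_pos)
  have "phi n \<alpha> lam (s * D) < 0"
    using phi_neg[OF assms(4,3,1,5), of "s * D"] sD s D by simp
  also have "phi n \<alpha> lam (s * D) =
      (n * D)\<^sup>2 * ((1 - \<alpha>) * s * L + \<alpha> * (s * (real n + 1)) * (1 + s / n) - lam * L\<^sup>2)"
    unfolding phi_eq D_def[symmetric] L t by (simp add: power2_eq_square algebra_simps)
  finally have "(1 - \<alpha>) * s * L + \<alpha> * (s * (real n + 1)) * (1 + s / n) < lam * L\<^sup>2"
    using n D mult_nonneg_nonneg[of "(n * D)\<^sup>2"] by (smt (verit) zero_le_power2)
  hence "((1 - \<alpha>) * s * L + \<alpha> * (s * (real n + 1)) * (1 + s / n)) / L\<^sup>2 < lam"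
    using L0 by (simp add: divide_less_eq)
  thus "(1 - \<alpha>) * s / L + \<alpha> * (s * (real n + 1)) * (1 + s / n) / L\<^sup>2 < lam"
    using L0 by (simp add: add_divide_distrib power2_eq_square)
qed

section \<open>Power series and limiting values at the origin\<close>

lemma class_A_mono:
  assumes "f \<in> class_A n" "m \<le> n"
  shows "f \<in> class_A m"
proof -
  obtain a where a: "\<And>z. z \<in> unit_disc \<Longrightarrow> (\<lambda>k. a (n + 1 + k) * z ^ (n + 1 + k)) sums (f z - z)"
    using assms unfolding class_A_def by blast
  \<comment> \<open>\<open>class_A n\<close> leaves \<open>a k\<close> arbitrary for
    \<open>k \<le> n\<close>, so these values are set to 0 before the series is started
    earlier.\<close>
  define b where "b k = (if k \<le> n then 0 else a k)" for k
  have "(\<lambda>k. b (m + 1 + k) * z ^ (m + 1 + k)) sums (f z - z)" if "z \<in> unit_disc" for z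
  proof -
    have "(\<lambda>k. b (m + 1 + (k + (n - m))) * z ^ (m + 1 + (k + (n - m)))) sums (f z - z)"
      using a[OF that] assms(2) by (simp add: b_def add_ac)
    thus ?thesis
      by (subst (asm) sums_zero_iff_shift) (auto simp: b_def)
  qed
  thus ?thesis using assms(1) unfolding class_A_def by blast
qed

lemma class_A_factor:
  assumes "f \<in> class_A n"
  obtains h where "h holomorphic_on unit_disc" "\<And>z. z \<in> unit_disc \<Longrightarrow> f z = z * (1 + z ^ n * h z)"
proof -
  obtain a where a: "\<And>z. z \<in> unit_disc \<Longrightarrow> (\<lambda>k. a (n + 1 + k) * z ^ (n + 1 + k)) sums (f z - z)"
    using assms unfolding class_A_def by blast
  define h where "h z = (\<Sum>k. a (n + 1 + k) * z ^ k)" for z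
  have s: "summable (\<lambda>k. a (n + 1 + k) * z ^ k)" if "z \<in> unit_disc" for z
  proof (cases "z = 0")
    case True
    thus ?thesis by (simp add: summable_zero_power')
  next
    case False
    from sums_summable[OF a[OF that]]
    have "summable (\<lambda>k. z ^ (n + 1) * (a (n + 1 + k) * z ^ k))" by (simp add: power_add mult_ac)
    from summable_mult[OF this, of "inverse (z ^ (n + 1))"] show ?thesis
      using False by (simp add: field_simps)
  qed
  have "h holomorphic_on unit_disc"
    by (rule power_series_holomorphic[of 0 1 "\<lambda>k. a (n + 1 + k)"])
       (use s in \<open>auto simp: h_def summable_sums\<close>)
  moreover have "f z = z * (1 + z ^ n * h z)" if "z \<in> unit_disc" for z
  proof -
    have "(\<lambda>k. z ^ (n + 1) * (a (n + 1 + k) * z ^ k)) sums (z ^ (n + 1) * h z)"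
      unfolding h_def by (intro sums_mult summable_sums s that)
    hence "(\<lambda>k. a (n + 1 + k) * z ^ (n + 1 + k)) sums (z ^ (n + 1) * h z)"
      by (simp add: power_add mult_ac)
    from sums_unique2[OF this a[OF that]] show ?thesis by (simp add: algebra_simps)
  qed
  ultimately show ?thesis using that by blast
qed

lemma lim_at_0_eq:
  assumes "open U" "0 \<in> U" "continuous_on U F" "\<And>w. w \<in> U \<Longrightarrow> w \<noteq> 0 \<Longrightarrow> g w = F w" "z \<in> U"
  shows "lim_at_0 g z = F z"
proof (cases "z = 0")
  case True
  have "F \<midarrow>0\<rightarrow> F 0"
    using assms by (simp add: continuous_on_eq_continuous_at isCont_def)
  moreover have "\<forall>\<^sub>F w in at 0. F w = g w"
    unfolding eventually_at_topological using assms by metis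
  ultimately have "g \<midarrow>0\<rightarrow> F 0" by (rule Lim_transform_eventually)
  thus ?thesis using True by (simp add: lim_at_0_def tendsto_Lim)
qed (use assms in \<open>auto simp: lim_at_0_def\<close>)

section \<open>The pointwise estimate and membership in \<open>class_G\<close>\<close>

text \<open>To be read with \<open>g = f z / z\<close>, \<open>p = z ^ n * q z\<close>,
  \<open>Z = z * deriv (deriv f) z\<close> and \<open>d = g + p = deriv f z\<close>. Since
  \<open>g / d - 1 = - p / d\<close>, the two terms with \<open>1 - \<alpha>\<close> combine into
  one that is small with \<open>p\<close>.\<close>

lemma class_G_term_bound:
  fixes p g Z :: complex and \<alpha> s t b L :: real
  assumes "0 \<le> \<alpha>" "\<alpha> \<le> 1" "L > 0" "g \<noteq> 0"
    and "cmod p \<le> s" "cmod g \<le> t" "cmod Z \<le> b" "L \<le> cmod (g + p)"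
  shows "cmod ((1 - of_real \<alpha> + of_real \<alpha> * (Z / (g + p))) / ((g + p) / g) - (1 - of_real \<alpha>))
           \<le> (1 - \<alpha>) * s / L + \<alpha> * b * t / L\<^sup>2"
proof -
  define d where "d = g + p"
  have d: "d \<noteq> 0" "L \<le> cmod d" using assms by (auto simp: d_def)
  have p: "p = d - g" by (simp add: d_def)
  have "(1 - of_real \<alpha> + of_real \<alpha> * (Z / d)) / (d / g) - (1 - of_real \<alpha>)
      = of_real \<alpha> * (Z * g) / d\<^sup>2 - of_real (1 - \<alpha>) * p / d"
    using d(1) assms(4) unfolding p by (simp add: field_simps power2_eq_square)
  also have "cmod \<dots> \<le> cmod (of_real \<alpha> * (Z * g) / d\<^sup>2) + cmod (of_real (1 - \<alpha>) * p / d)"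
    by (rule norm_triangle_ineq4)
  also have "\<dots> = \<alpha> * (cmod Z * cmod g) / (cmod d)\<^sup>2 + (1 - \<alpha>) * cmod p / cmod d"
    using assms(1,2) by (simp add: norm_mult norm_divide norm_power del: of_real_diff)
  also have "\<dots> \<le> \<alpha> * (b * t) / L\<^sup>2 + (1 - \<alpha>) * s / L"
    using assms d norm_ge_zero[of Z] norm_ge_zero[of p]
    by (intro add_mono frac_le mult_left_mono mult_mono power_mono mult_nonneg_nonneg)
       (auto intro: order_trans[OF norm_ge_zero])
  finally show ?thesis by (simp add: d_def algebra_simps)
qed

theorem theorem2p1:
  fixes n :: nat and f :: "complex \<Rightarrow> complex" and \<alpha> lam \<delta> :: real
  assumes "n \<ge> 1"
    and "f \<in> class_A n"
    and "0 \<le> \<alpha>" and "\<alpha> < 1"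
    and "lam > 0"
    and "smallest_positive_root (phi n \<alpha> lam) \<delta>"
    and "\<And>z. z \<in> unit_disc \<Longrightarrow>
           cmod (z * deriv (deriv f) z
                 - of_real \<alpha> * (deriv f z - lim_at_0 (\<lambda>w. f w / w) z)) < \<delta>"
  shows "f \<in> class_G lam \<alpha>"
proof -
  obtain h where h: "h holomorphic_on unit_disc"
    and f: "\<And>z. z \<in> unit_disc \<Longrightarrow> f z = z * (1 + z ^ n * h z)"
    using class_A_factor[OF assms(2)] by metis
  \<comment> \<open>Chosen so that \<open>z * deriv g z = z ^ n * q z\<close>, where
    \<open>g\<close> is \<open>f z / z\<close> extended over 0.\<close>
  define q where "q z = of_real (real n) * h z + z * deriv h z" for z
  define g where "g z = 1 + z ^ n * h z" for z
  have q: "q holomorphic_on unit_disc"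
    unfolding q_def by (intro holomorphic_intros h) auto
  have dh: "(h has_field_derivative deriv h z) (at z)"
    and dq: "(q has_field_derivative deriv q z) (at z)" if "z \<in> unit_disc" for z
    using that h q by (auto intro: holomorphic_derivI)
  have zn: "z * z ^ (n - 1) = z ^ n" for z :: complex
    using assms(1) by (simp flip: power_Suc)
  have f': "deriv f z = g z + z ^ n * q z" if z: "z \<in> unit_disc" for z
  proof -
    have "((\<lambda>z. z * (1 + z ^ n * h z)) has_field_derivative g z + z ^ n * q z) (at z)"
      by (rule derivative_eq_intros dh z refl)+
        (simp add: g_def q_def algebra_simps flip: zn)
    hence "(f has_field_derivative g z + z ^ n * q z) (at z)"
      by (rule has_field_derivative_transform_within_open[of _ _ _ unit_disc]) (use z f in auto)
    thus ?thesis by (rule DERIV_imp_deriv)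
  qed
  have f'': "z * deriv (deriv f) z = z ^ n * ((real n + 1) * q z + z * deriv q z)"
    if z: "z \<in> unit_disc" for z
  proof -
    define d where "d = of_nat n * z ^ (n - 1) * h z + z ^ n * deriv h z
      + (of_nat n * z ^ (n - 1) * q z + z ^ n * deriv q z)"
    have "((\<lambda>z. g z + z ^ n * q z) has_field_derivative d) (at z)"
      unfolding g_def d_def
      by (rule derivative_eq_intros dh dq z refl)+ (simp add: algebra_simps)
    hence "(deriv f has_field_derivative d) (at z)"
      by (rule has_field_derivative_transform_within_open[of _ _ _ unit_disc]) (use z f' in auto)
    hence "z * deriv (deriv f) z = z * d" by (simp add: DERIV_imp_deriv)
    also have "\<dots> = z ^ n * ((real n + 1) * q z + z * deriv q z)"
      unfolding d_def by (simp add: q_def algebra_simps flip: zn)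
    finally show ?thesis .
  qed

  \<comment> \<open>The factor \<open>n + 1\<close> of \<open>q\<close> in \<open>f''\<close>, less
    the \<alpha> coming from \<open>deriv f z - f z / z = z ^ n * q z\<close>.\<close>
  define D where "D = real n + 1 - \<alpha>"
  define S where "S = \<delta> / D"
  define W where "W z = of_real D * q z + z * deriv q z" for z
  have D: "D > 0" using assms by (simp add: D_def)
  have \<delta>: "\<delta> > 0" using assms(6) by (simp add: smallest_positive_root_def)
  have W_bound: "cmod (W z) \<le> \<delta>" if "cmod z < 1" for z
  proof (rule Schwarz_power[OF _ _ that, where n = n])
    show "W holomorphic_on unit_disc"
      unfolding W_def by (intro holomorphic_intros q) auto
    fix z :: complex assume z: "cmod z < 1" "z \<noteq> 0"
    have "z * deriv (deriv f) z - of_real \<alpha> * (deriv f z - lim_at_0 (\<lambda>w. f w / w) z) = z ^ n * W z"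
    proof -
      have "f z / z = g z" using z f[of z] by (simp add: g_def)
      thus ?thesis using z by (simp add: f' f'' lim_at_0_def W_def D_def algebra_simps)
    qed
    thus "cmod (z ^ n * W z) \<le> \<delta>" using assms(7)[of z] z by simp
  qed
  have q_bound: "cmod (q z) \<le> S" if "cmod z < 1" for z
    unfolding S_def by (rule Euler_operator_bound[OF q D _ that]) (use W_bound W_def in auto)
  have h_bound: "cmod (h z) \<le> S / n" if "cmod z < 1" for z
    by (rule Euler_operator_bound[OF h _ _ that]) (use q_bound q_def assms(1) in auto)

  have main: "deriv f z \<noteq> 0 \<and> g z \<noteq> 0 \<and>
      cmod ((1 - of_real \<alpha> + of_real \<alpha> * (z * deriv (deriv f) z / deriv f z))
                / (deriv f z / g z) - (1 - of_real \<alpha>)) < lam" if z: "z \<in> unit_disc" for z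
  proof -
    define s where "s = S * cmod z ^ n"
    define L where "L = 1 - s * (real n + 1) / n"
    have n: "real n > 0" using assms(1) by simp
    have z1: "cmod z < 1" using z by simp
    have S0: "S > 0" using D \<delta> by (simp add: S_def)
    \<comment> \<open>The bounds on \<open>W\<close>, \<open>q\<close> and \<open>h\<close> are not
      strict; the strict inequality comes from here and needs \<open>n \<ge> 1\<close>.\<close>
    have "cmod z ^ n < 1" using z1 assms(1) by (simp add: power_less_one_iff)
    hence "s < S" using S0 by (simp add: s_def)
    hence s: "0 \<le> s" "s < \<delta> / (real n + 1 - \<alpha>)"
      using S0 by (simp_all add: s_def flip: S_def D_def)
    note est = phi_estimate[OF assms(1,3-6) s, folded L_def]
    have p: "cmod (z ^ n * q z) \<le> s"
      using q_bound[OF z1] by (simp add: s_def norm_mult norm_power mult.commute[of "cmod z ^ n"] mult_right_mono)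
    have "cmod z ^ n * cmod (h z) \<le> cmod z ^ n * (S / n)"
      using h_bound[OF z1] by (intro mult_left_mono) auto
    hence g1: "cmod (z ^ n * h z) \<le> s / n" by (simp add: s_def norm_mult norm_power mult.commute)
    have g: "cmod (g z) \<le> 1 + s / n"
      using norm_triangle_ineq[of 1 "z ^ n * h z"] g1 unfolding g_def by simp
    \<comment> \<open>As \<open>n + 1 = D + \<alpha>\<close>, the second derivative is expressed by
      \<open>W\<close> and \<open>q\<close>, and \<open>\<delta> = S * D\<close> turns the bound
      into \<open>S * (n + 1)\<close>.\<close>
    have "cmod (W z + of_real \<alpha> * q z) \<le> \<delta> + \<alpha> * S"
      using norm_triangle_ineq[of "W z" "of_real \<alpha> * q z"] W_bound[OF z1]
        mult_left_mono[OF q_bound[OF z1] assms(3)] assms(3) by (simp add: norm_mult)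
    also have "\<dots> = S * (real n + 1)" using D by (simp add: S_def D_def field_simps)
    finally have "cmod z ^ n * cmod (W z + of_real \<alpha> * q z) \<le> cmod z ^ n * (S * (real n + 1))"
      by (intro mult_left_mono) auto
    moreover have "z * deriv (deriv f) z = z ^ n * (W z + of_real \<alpha> * q z)"
      using f''[OF z] by (simp add: W_def D_def algebra_simps)
    ultimately have Z: "cmod (z * deriv (deriv f) z) \<le> s * (real n + 1)"
      by (simp add: s_def norm_mult norm_power mult_ac)
    have L: "L = 1 - s / n - s" using n by (simp add: L_def field_simps)
    \<comment> \<open>The number 1 is \<open>g z + z ^ n * q z\<close> minus
      \<open>z ^ n * h z + z ^ n * q z\<close>.\<close>
    have "1 \<le> cmod (g z + z ^ n * q z) + cmod (z ^ n * h z) + cmod (z ^ n * q z)"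
      using norm_triangle_ineq4[of "g z + z ^ n * q z" "z ^ n * h z + z ^ n * q z"]
        norm_triangle_ineq[of "z ^ n * h z" "z ^ n * q z"] by (simp add: g_def)
    hence d: "L \<le> cmod (g z + z ^ n * q z)" using p g1 L by simp
    have "s / n < 1" using est(1) s L by simp
    hence g0: "g z \<noteq> 0" using g1 by (auto simp: g_def add_eq_0_iff)
    have "cmod ((1 - of_real \<alpha> + of_real \<alpha> * (z * deriv (deriv f) z / deriv f z))
                / (deriv f z / g z) - (1 - of_real \<alpha>))
        \<le> (1 - \<alpha>) * s / L + \<alpha> * (s * (real n + 1)) * (1 + s / n) / L\<^sup>2"
      unfolding f'[OF z]
      by (rule class_G_term_bound[OF assms(3) _ est(1) g0 p g Z d]) (use assms(4) in simp)
    also have "\<dots> < lam" by (rule est(2))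
    finally show ?thesis using g0 d est(1) f'[OF z] by auto
  qed
  \<comment> \<open>Cancelling \<open>w\<close> in \<open>f w = w * g w\<close> removes the
    singularity at 0; the quotient by \<open>g\<close> is continuous because \<open>main\<close>
    makes \<open>g\<close> zero-free.\<close>
  have lim: "lim_at_0 (\<lambda>w. w * deriv f w / f w) z = deriv f z / g z" if "z \<in> unit_disc" for z
  proof (rule lim_at_0_eq[of unit_disc])
    have "(\<lambda>w. (g w + w ^ n * q w) / g w) holomorphic_on unit_disc"
      using main unfolding g_def by (intro holomorphic_intros h q) auto
    hence "continuous_on unit_disc (\<lambda>w. (g w + w ^ n * q w) / g w)"
      by (rule holomorphic_on_imp_continuous_on)
    thus "continuous_on unit_disc (\<lambda>w. deriv f w / g w)"
      by (rule continuous_on_eq) (use f' in auto)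
  qed (use that f g_def in auto)
  have "f z \<noteq> 0" if "z \<in> unit_disc" "z \<noteq> 0" for z
    using main[OF that(1)] f[OF that(1)] that by (simp add: g_def)
  thus ?thesis
    unfolding class_G_def using main lim class_A_mono[OF assms(2,1)] by auto
qed

end
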